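(* The set of primitive Pythagorean triples (with first leg odd) is the set of nodes of an infinite ternary tree, in which demotion moves up one level from a triple to its parent, and promotion moves down one level, producing from each triple its three immediate successors (children). The only triple with no parent is the root $[3,4,5]$.
   Context: A primitive Pythagorean triple $[a,b,c]$ consists of positive integers with $a^2+b^2=c^2$ and $\gcd(a,b,c)=1$; by convention $a$ is odd. A valid sequence is $\mathcal{P}=[q',q,p,p']$ where $q'$ is an odd positive integer, $q$ is a positive integer with $\gcd(q',q)=1$, $p=q'+q$ and $p'=q+p$. Valid sequences correspond bijectively to primitive triples via $[a,b,c]=[p'q',\,2pq,\,p^2+q^2]$; the sequence $[1,1,2,3]$ corresponds to $[3,4,5]$. The three promotions of a valid sequence $[q',q,p,p']$ are the valid sequences whose first two entries are $(q',p)$, $(p',q)$ and $(p',p)$ respectively (the last two entries being computed by the rule above). Promotions of a triple are the triples corresponding to the promotions of its valid sequence; these are its children. A demotion (parent) of a triple $T$ is a triple having $T$ as one of its promotions. *)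

theory Defs
  imports Main "Graph_Theory.Digraph" "Graph_Theory.Arc_Walk"
begin

type_synonym triple = "nat \<times> nat \<times> nat"
type_synonym pyth_seq = "nat \<times> nat \<times> nat \<times> nat"

definition primitive_triples :: "triple set" where
  "primitive_triples = {(a, b, c). 0 < a \<and> 0 < b \<and> 0 < c \<and>
     a\<^sup>2 + b\<^sup>2 = c\<^sup>2 \<and> Gcd {a, b, c} = 1 \<and> odd a}"

definition seq_from :: "nat \<Rightarrow> nat \<Rightarrow> pyth_seq" where
  "seq_from q' q = (let p = q' + q in (q', q, p, q + p))"

definition valid_seqs :: "pyth_seq set" where
  "valid_seqs = {seq_from q' q | q' q. odd q' \<and> 0 < q \<and> gcd q' q = 1}"

fun triple_of :: "pyth_seq \<Rightarrow> triple" where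
  "triple_of (q', q, p, p') = (p' * q', 2 * p * q, p\<^sup>2 + q\<^sup>2)"

fun seq_promotions :: "pyth_seq \<Rightarrow> pyth_seq set" where
  "seq_promotions (q', q, p, p') = {seq_from q' p, seq_from p' q, seq_from p' p}"

text \<open>
  A primitive triple has exactly one valid sequence; quantifying over all valid sequences
  of \<open>T\<close> avoids having to choose it.
\<close>
definition promotions :: "triple \<Rightarrow> triple set" where
  "promotions T = {triple_of S' | S S'. S \<in> valid_seqs \<and> triple_of S = T \<and> S' \<in> seq_promotions S}"

definition demotions :: "triple \<Rightarrow> triple set" where
  "demotions T = {P \<in> primitive_triples. T \<in> promotions P}"

text \<open>
  The arcs are deliberately not restricted to pairs of primitive triples, so that
  well-formedness of the digraph says that promotion leads from primitive triples to
  primitive triples.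
\<close>
definition triple_graph :: "(triple, triple \<times> triple) pre_digraph" where
  "triple_graph = \<lparr> verts = primitive_triples, arcs = {(P, T). T \<in> promotions P},
                    tail = fst, head = snd \<rparr>"

text \<open>
  The predicate \<open>tree\<close> of the digraph library only forbids directed cycles, so it does
  not rule out nodes with several parents. A rooted tree with arcs pointing away from the root
  is instead a digraph in which every node is reached from the root by exactly one walk.
\<close>
locale rooted_tree = wf_digraph G for G :: "('a, 'b) pre_digraph" +
  fixes root :: 'a
  assumes root_in_verts: "root \<in> verts G"
    and unique_awalk: "v \<in> verts G \<Longrightarrow> \<exists>!p. awalk root p v"

definition infinite_ternary_tree :: "('a, 'b) pre_digraph \<Rightarrow> 'a \<Rightarrow> bool" where
  "infinite_ternary_tree G r \<longleftrightarrow>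
     rooted_tree G r \<and> infinite (verts G) \<and> (\<forall>v \<in> verts G. out_degree G v = 3)"

text \<open>The number of arcs on the walk from the root \<open>r\<close> to \<open>v\<close>; meaningful in a rooted tree.\<close>
definition tree_level :: "('a, 'b) pre_digraph \<Rightarrow> 'a \<Rightarrow> 'a \<Rightarrow> nat" where
  "tree_level G r v = length (THE p. pre_digraph.awalk G r p v)"

end

theory Submission
  imports Defs "HOL-Computational_Algebra.Nth_Powers"
begin

text \<open>
  Write \<open>(x, y)\<close> for the first two entries of a valid sequence. Since \<open>c + b = (x + 2 * y)\<^sup>2\<close> and
  \<open>c - b = x\<^sup>2\<close>, the triple determines \<open>(x, y)\<close>; conversely, \<open>c + b\<close> and \<open>c - b\<close> are coprime with
  product \<open>a\<^sup>2\<close>, hence are squares. The three promotions of \<open>(x, y)\<close> lie in the disjoint regions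
  \<open>v > u\<close>, \<open>u > 2 * v\<close> and \<open>v < u < 2 * v\<close> of pairs \<open>(u, v)\<close>, and in each region the promotion is
  inverted by subtractions. As \<open>u\<close> is odd and coprime to \<open>v\<close>, the only valid pair outside
  the regions is \<open>(1, 1)\<close>. Promotion increases the hypotenuse, so descent yields the tree.
\<close>

section \<open>Trees from unique parents\<close>

text \<open>Since \<open>rank\<close> drops from head to tail, induction applies: a walk to
  \<open>v\<close> other than \<open>r\<close> must end with the only arc into \<open>v\<close>, so
  it extends the unique walk to the tail of that arc. No arc enters \<open>r\<close>, so only the
  empty walk reaches it.\<close>

lemma (in wf_digraph) rooted_treeI:
  fixes rank :: "'a \<Rightarrow> nat"
  assumes root: "r \<in> verts G" "in_arcs G r = {}"
    and parent: "\<And>v. v \<in> verts G \<Longrightarrow> v \<noteq> r \<Longrightarrow> \<exists>!e. e \<in> in_arcs G v"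
    and rank: "\<And>e. e \<in> arcs G \<Longrightarrow> rank (tail G e) < rank (head G e)"
  shows "rooted_tree G r"
proof unfold_locales
  fix v assume "v \<in> verts G"
  then show "\<exists>!p. awalk r p v"
  proof (induction "rank v" arbitrary: v rule: less_induct)
    case less
    have last_arc: "awalk r p (tail G e) \<and> e \<in> in_arcs G v" if "awalk r (p @ [e]) v" for p e
      using that by (auto simp: awalk_simps)
    show ?case
    proof (cases "v = r")
      case True
      have "p = []" if "awalk r p v" for p
        using that last_arc root(2) True by (cases p rule: rev_cases) auto
      moreover have "awalk r [] v"
        using True root(1) by (simp add: awalk_simps)
      ultimately show ?thesis by blast
    next
      case False
      obtain e where e: "e \<in> in_arcs G v" and uniq: "\<And>e'. e' \<in> in_arcs G v \<Longrightarrow> e' = e"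
        using parent[OF less.prems False] by blast
      have arc: "e \<in> arcs G" "head G e = v" using e by auto
      obtain p where p: "awalk r p (tail G e)" "\<And>p'. awalk r p' (tail G e) \<Longrightarrow> p' = p"
        using less.hyps[of "tail G e"] rank[OF arc(1)] arc by auto
      have "awalk r (p @ [e]) v"
        using awalk_appendI[OF p(1) arc_implies_awalk[OF arc(1)]] arc(2) by simp
      moreover have "p' = p @ [e]" if w: "awalk r p' v" for p'
      proof (cases p' rule: rev_cases)
        case Nil
        then show ?thesis using w False by (auto simp: awalk_simps)
      next
        case (snoc p'' e')
        then show ?thesis using w p(2) uniq last_arc by blast
      qed
      ultimately show ?thesis by blast
    qed
  qed
qed (fact root(1))

text \<open>The walk to the head is the walk to the tail followed by \<open>e\<close>; uniqueness of
  walks lets both definite descriptions be evaluated.\<close>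

lemma tree_level_head:
  assumes "rooted_tree G r" "e \<in> arcs G"
  shows "tree_level G r (head G e) = tree_level G r (tail G e) + 1"
proof -
  interpret rooted_tree G r by fact
  obtain p where p: "awalk r p (tail G e)"
    using unique_awalk[OF tail_in_verts[OF assms(2)]] by blast
  have pe: "awalk r (p @ [e]) (head G e)"
    using awalk_appendI[OF p arc_implies_awalk[OF assms(2)]] .
  have "(THE p. awalk r p (tail G e)) = p"
    using p unique_awalk[OF tail_in_verts[OF assms(2)]] by (intro the1_equality)
  moreover have "(THE p. awalk r p (head G e)) = p @ [e]"
    using pe unique_awalk[OF head_in_verts[OF assms(2)]] by (intro the1_equality)
  ultimately show ?thesis by (simp add: tree_level_def)
qed

section \<open>Valid pairs and primitive triples\<close>

text \<open>Since \<open>seq_from\<close> computes the last two entries, a pair stands for a whole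
  valid sequence.\<close>

definition valid_pair :: "nat \<Rightarrow> nat \<Rightarrow> bool" where
  "valid_pair x y \<longleftrightarrow> odd x \<and> 0 < y \<and> coprime x y"

definition triple_from :: "nat \<Rightarrow> nat \<Rightarrow> triple" where
  "triple_from x y = triple_of (seq_from x y)"

lemma triple_from_eq:
  "triple_from x y = ((x + 2 * y) * x, 2 * (x + y) * y, (x + y)\<^sup>2 + y\<^sup>2)"
  by (simp add: triple_from_def seq_from_def Let_def algebra_simps)

lemma valid_seqs_eq: "valid_seqs = {seq_from x y | x y. valid_pair x y}"
  by (simp add: valid_seqs_def valid_pair_def coprime_iff_gcd_eq_1)

lemma triple_from_inject: "triple_from x y = triple_from u v \<longleftrightarrow> x = u \<and> y = v"
proof
  assume eq: "triple_from x y = triple_from u v"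
  have sum: "2 * (x + y) * y + ((x + y)\<^sup>2 + y\<^sup>2) = (x + 2 * y)\<^sup>2" for x y :: nat
    by (simp add: power2_eq_square algebra_simps)
  \<comment> \<open>This is \<open>c - b = x\<^sup>2\<close>, written additively to avoid truncated
    subtraction.\<close>
  have diff: "x\<^sup>2 + 2 * (x + y) * y = (x + y)\<^sup>2 + y\<^sup>2" for x y :: nat
    by (simp add: power2_eq_square algebra_simps)
  have "(x + 2 * y)\<^sup>2 = (u + 2 * v)\<^sup>2"
    using eq sum[of x y] sum[of u v] unfolding triple_from_eq prod.inject by metis
  moreover have "x\<^sup>2 = u\<^sup>2"
    using eq diff[of x y] diff[of u v] unfolding triple_from_eq prod.inject by linarith
  ultimately show "x = u \<and> y = v" by simp
qed simp

text \<open>Each pair on the left arises from \<open>x\<close>, \<open>y\<close> by repeatedly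
  adding one entry to the other, as in Euclid's algorithm. The equivalences serve both promotion and
  descent.\<close>

lemma coprime_promote:
  fixes x y :: nat
  shows "coprime x (x + y) \<longleftrightarrow> coprime x y"
    and "coprime (x + 2 * y) y \<longleftrightarrow> coprime x y"
    and "coprime (x + 2 * y) (x + y) \<longleftrightarrow> coprime x y"
proof -
  have add: "coprime (m + n) n \<longleftrightarrow> coprime m n" "coprime n (n + m) \<longleftrightarrow> coprime n m"
    for m n :: nat by (simp_all add: coprime_iff_gcd_eq_1)
  show "coprime x (x + y) \<longleftrightarrow> coprime x y" by (rule add(2))
  show "coprime (x + 2 * y) y \<longleftrightarrow> coprime x y"
    using add(1)[of "x + y" y] add(1)[of x y] by (simp add: mult_2 add.assoc)
  show "coprime (x + 2 * y) (x + y) \<longleftrightarrow> coprime x y"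
    using add(1)[of y "x + y"] add(2)[of y x]
    by (simp add: mult_2 add_ac coprime_commute)
qed

lemma triple_from_primitive:
  assumes "valid_pair x y"
  shows "triple_from x y \<in> primitive_triples"
proof -
  have xy: "odd x" "0 < y" "coprime x y" and x: "0 < x"
    using assms by (auto simp: valid_pair_def odd_pos)
  \<comment> \<open>Both factors of the first leg are odd and coprime to \<open>x + y\<close> and to
    \<open>y\<close>. Coprime legs already force the \<open>Gcd\<close> of all three entries to be
    1.\<close>
  have "coprime ((x + 2 * y) * x) (2 * (x + y) * y)"
    using xy coprime_promote[of x y] by (simp del: distrib_left_numeral)
  then have "Gcd {(x + 2 * y) * x, 2 * (x + y) * y, (x + y)\<^sup>2 + y\<^sup>2} = 1"
    by (simp add: gcd.assoc [symmetric] coprime_iff_gcd_eq_1 del: gcd.assoc)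
  moreover have "((x + 2 * y) * x)\<^sup>2 + (2 * (x + y) * y)\<^sup>2 = ((x + y)\<^sup>2 + y\<^sup>2)\<^sup>2"
    by (simp add: power2_eq_square algebra_simps)
  ultimately show ?thesis
    using xy x by (simp add: primitive_triples_def triple_from_eq)
qed

text \<open>Squares are 0 or 1 modulo 4, so two odd legs would give the impossible residue
  2.\<close>

lemma primitive_triple_parity:
  fixes a b c :: nat
  assumes "a\<^sup>2 + b\<^sup>2 = c\<^sup>2" "odd a"
  shows "even b" "odd c"
proof -
  have sq: "n\<^sup>2 mod 4 = (if even n then 0 else 1)" for n :: nat
  proof (cases "even n")
    case False
    then obtain k where "n = 2 * k + 1" by (rule oddE)
    then have "n\<^sup>2 = 4 * (k\<^sup>2 + k) + 1" by (simp add: power2_eq_square algebra_simps)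
    then show ?thesis using False by presburger
  qed (auto elim!: evenE simp: power2_eq_square)
  have "(a\<^sup>2 mod 4 + b\<^sup>2 mod 4) mod 4 = c\<^sup>2 mod 4"
    using assms(1) by (simp add: mod_simps)
  then show "even b" "odd c"
    using assms(2) unfolding sq by (auto split: if_splits)
qed

text \<open>With \<open>c - b = s\<^sup>2\<close> and \<open>c + b = t\<^sup>2\<close>, the pair is
  \<open>s\<close> and half of \<open>t - s\<close>, where \<open>s\<close> and \<open>t\<close> are
  both odd.\<close>

lemma primitive_triple_from:
  assumes "T \<in> primitive_triples"
  obtains x y where "valid_pair x y" "T = triple_from x y"
proof -
  obtain a b c where T: "T = (a, b, c)" and pos: "0 < a" "0 < b" "0 < c"
    and pyth: "a\<^sup>2 + b\<^sup>2 = c\<^sup>2" and g: "Gcd {a, b, c} = 1" and a: "odd a"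
    using assms by (auto simp: primitive_triples_def)
  note par = primitive_triple_parity[OF pyth a]
  have bc: "b < c"
    using pyth pos(1) by (intro power_less_imp_less_base[of b 2 c]) (auto simp flip: pyth)
  have prod: "(c - b) * (c + b) = a\<^sup>2"
  proof -
    have "(c - b) * (c + b) = c\<^sup>2 - b\<^sup>2"
      using bc by (simp add: power2_eq_square algebra_simps diff_mult_distrib)
    then show ?thesis using pyth by simp
  qed
  \<comment> \<open>A common divisor is odd because \<open>c + b\<close> is, so from
    \<open>2 * b\<close> and \<open>2 * c\<close> it divides \<open>b\<close> and \<open>c\<close>.
    Primitivity makes it coprime to \<open>a\<close>, yet it divides
    \<open>a\<^sup>2\<close>.\<close>
  have cop: "coprime (c - b) (c + b)"
  proof (rule coprimeI)
    fix d assume d: "d dvd c - b" "d dvd c + b"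
    have "odd d" using d(2) par by (meson dvd_trans even_add)
    have "2 * c = (c + b) + (c - b)" "2 * b = (c + b) - (c - b)" using bc by auto
    then have "d dvd 2 * c" "d dvd 2 * b" using d by (metis dvd_add, metis dvd_diff_nat)
    then have dcb: "d dvd c" "d dvd b"
      using \<open>odd d\<close> by (simp_all add: coprime_dvd_mult_right_iff)
    have "coprime d a"
    proof (rule coprimeI)
      fix k assume "k dvd d" "k dvd a"
      then have "k dvd Gcd {a, b, c}"
        using dcb by (intro Gcd_greatest) (auto intro: dvd_trans)
      then show "is_unit k" unfolding g .
    qed
    then have "coprime d (a\<^sup>2)" by simp
    moreover have "d dvd a\<^sup>2" using d(1) prod by (metis dvd_mult2)
    ultimately show "is_unit d" by (metis coprime_absorb_left)
  qed
  have "is_square ((c - b) * (c + b))" unfolding prod ..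
  then obtain s t where s: "c - b = s\<^sup>2" and t: "c + b = t\<^sup>2"
    using is_nth_power_mult_coprime_nat_iff[OF cop] by (auto elim!: is_nth_powerE)
  have odd: "odd s" "odd t"
    using s t par bc by (metis even_power even_diff_nat even_add not_less_iff_gr_or_eq pos2,
      metis even_power even_add pos2)
  have "s\<^sup>2 < t\<^sup>2" using s t pos(2) bc by linarith
  then have "s < t" by (rule power_less_imp_less_base) simp
  moreover have "even (t - s)" using odd by simp
  ultimately obtain y where y: "t = s + 2 * y" "0 < y"
    by (metis add_diff_inverse_nat dvdE not_less zero_less_diff mult_0_right gr0I less_irrefl less_imp_le)
  have "coprime s t" using cop unfolding s t by simp
  then have "valid_pair s y"
    using y odd coprime_promote(1)[of s "2 * y"] by (simp add: valid_pair_def)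
  moreover have "T = triple_from s y"
  proof -
    have "2 * c = s\<^sup>2 + t\<^sup>2" "2 * b + s\<^sup>2 = t\<^sup>2" using s t bc by linarith+
    then have "c = (s + y)\<^sup>2 + y\<^sup>2" "b = 2 * (s + y) * y"
      by (simp_all add: y power2_eq_square algebra_simps)
    moreover have "a\<^sup>2 = (t * s)\<^sup>2" using prod s t by (simp add: power_mult_distrib mult.commute)
    then have "a = (s + 2 * y) * s" using y by simp
    ultimately show ?thesis by (simp add: T triple_from_eq)
  qed
  ultimately show thesis using that by blast
qed

section \<open>Promotions\<close>

lemma valid_pair_promote:
  assumes "valid_pair x y"
  shows "valid_pair x (x + y)" "valid_pair (x + 2 * y) y" "valid_pair (x + 2 * y) (x + y)"
  using assms coprime_promote[of x y] by (auto simp: valid_pair_def)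

lemma promotions_iff:
  "T' \<in> promotions T \<longleftrightarrow>
    (\<exists>x y. valid_pair x y \<and> T = triple_from x y \<and> T' \<in> triple_of ` seq_promotions (seq_from x y))"
  unfolding promotions_def valid_seqs_eq triple_from_def by blast

text \<open>By injectivity of \<open>triple_from\<close>, only one valid sequence contributes to the
  promotions of a given triple.\<close>

lemma promotions_triple_from:
  assumes "valid_pair x y"
  shows "promotions (triple_from x y) =
    {triple_from x (x + y), triple_from (x + 2 * y) y, triple_from (x + 2 * y) (x + y)}"
proof -
  have "promotions (triple_from x y) = triple_of ` seq_promotions (seq_from x y)"
    using assms unfolding set_eq_iff promotions_iff triple_from_inject by blast
  also have "\<dots> = {triple_from x (x + y), triple_from (x + 2 * y) y, triple_from (x + 2 * y) (x + y)}"
    by (simp add: triple_from_eq seq_from_def Let_def mult_2 add_ac)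
  finally show ?thesis .
qed

lemma promotions_primitive:
  assumes "T' \<in> promotions T"
  shows "T \<in> primitive_triples" "T' \<in> primitive_triples"
proof -
  obtain x y where "valid_pair x y" "T = triple_from x y"
    using assms unfolding promotions_iff by blast
  then show "T \<in> primitive_triples" "T' \<in> primitive_triples"
    using assms by (auto simp: promotions_triple_from intro!: triple_from_primitive valid_pair_promote)
qed

lemma card_promotions:
  assumes "T \<in> primitive_triples"
  shows "card (promotions T) = 3"
proof -
  obtain x y where "valid_pair x y" "T = triple_from x y"
    using assms by (rule primitive_triple_from)
  then show ?thesis
    by (auto simp: promotions_triple_from triple_from_inject valid_pair_def odd_pos card_insert_if)
qed

text \<open>In \<open>p\<^sup>2 + q\<^sup>2\<close>, with \<open>p = x + y\<close> and
  \<open>q = y\<close>, every promotion increases \<open>p\<close> and never decreases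
  \<open>q\<close>. The hypotenuse thus serves as the rank for descent.\<close>

lemma promotions_hypotenuse:
  assumes "T' \<in> promotions T"
  shows "snd (snd T) < snd (snd T')"
proof -
  obtain x y where xy: "valid_pair x y" "T = triple_from x y"
    using promotions_primitive(1)[OF assms] by (rule primitive_triple_from)
  then have "0 < x" "0 < y" by (auto simp: valid_pair_def odd_pos)
  then show ?thesis
    using assms unfolding xy(2) promotions_triple_from[OF xy(1)]
    by (auto simp: triple_from_eq power2_eq_square algebra_simps)
qed

section \<open>Parents: inverting the promotions on pairs\<close>

definition promotes :: "nat \<Rightarrow> nat \<Rightarrow> nat \<Rightarrow> nat \<Rightarrow> bool" where
  "promotes x y u v \<longleftrightarrow> valid_pair x y \<and>
    (u = x \<and> v = x + y \<or> u = x + 2 * y \<and> v = y \<or> u = x + 2 * y \<and> v = x + y)"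

lemma demotions_triple_from:
  "demotions (triple_from u v) = {triple_from x y | x y. promotes x y u v}"
proof (intro equalityI subsetI)
  fix P assume "P \<in> demotions (triple_from u v)"
  then have P: "P \<in> primitive_triples" "triple_from u v \<in> promotions P"
    by (auto simp: demotions_def)
  obtain x y where "valid_pair x y" "P = triple_from x y"
    using P(1) by (rule primitive_triple_from)
  then show "P \<in> {triple_from x y | x y. promotes x y u v}"
    using P(2) by (auto simp: promotions_triple_from triple_from_inject promotes_def)
next
  fix P assume "P \<in> {triple_from x y | x y. promotes x y u v}"
  then show "P \<in> demotions (triple_from u v)"
    by (auto simp: demotions_def promotes_def promotions_triple_from intro: triple_from_primitive)
qed

text \<open>Positivity of \<open>x\<close> and \<open>y\<close> puts the three kinds of child into
  disjoint regions, so the child reveals which promotion was used, and each promotion is an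
  injective linear map.\<close>

lemma promotes_unique:
  assumes "promotes x y u v" "promotes x' y' u v"
  shows "x = x'" "y = y'"
  using assms by (auto simp: promotes_def valid_pair_def)

lemma promotes_exists:
  assumes uv: "valid_pair u v" and ne: "(u, v) \<noteq> (1, 1)"
  obtains x y where "promotes x y u v"
proof -
  have u: "odd u" "0 < u" "0 < v" and cop: "coprime u v"
    using uv by (auto simp: valid_pair_def odd_pos)
  \<comment> \<open>The region boundaries are excluded: \<open>u = v\<close> is coprime only for
    \<open>(1, 1)\<close>, and \<open>u = 2 * v\<close> contradicts oddness of
    \<open>u\<close>.\<close>
  have "u \<noteq> v" using cop ne by auto
  then consider "u < v" | "2 * v < u" | "v < u" "u < 2 * v" using u(1)
    by (metis dvd_triv_left linorder_neqE_nat)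
  then show thesis
  proof cases
    case 1
    then obtain y where y: "v = u + y" "0 < y" using less_imp_add_positive by blast
    with cop u have "promotes u y u v"
      by (auto simp: promotes_def valid_pair_def coprime_iff_gcd_eq_1)
    then show thesis by (rule that)
  next
    case 2
    then obtain x where x: "u = 2 * v + x" "0 < x" using less_imp_add_positive by blast
    have "coprime x v" using coprime_promote(2)[of x v] cop x by (simp add: add.commute)
    with u x have "promotes x v u v" by (auto simp: promotes_def valid_pair_def)
    then show thesis by (rule that)
  next
    case 3
    \<comment> \<open>Solving \<open>u = x + 2 * y\<close>, \<open>v = x + y\<close> gives
      \<open>y = u - v\<close> and \<open>x = 2 * v - u\<close>, both positive in this
      region.\<close>
    then obtain y where y: "u = v + y" "0 < y" using less_imp_add_positive by blast
    with 3 obtain x where x: "v = y + x" using less_imp_add_positive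
      by (metis add_less_cancel_left mult_2)
    have "u = x + 2 * y" "v = x + y" using x y by auto
    moreover from this have "coprime x y" using coprime_promote(3)[of x y] cop by simp
    ultimately have "promotes x y u v"
      using u y by (auto simp: promotes_def valid_pair_def)
    then show thesis by (rule that)
  qed
qed

lemma root_eq: "(3, 4, 5) = triple_from 1 1"
  by (simp add: triple_from_eq power2_eq_square)

lemma root_primitive: "(3, 4, 5) \<in> primitive_triples"
  unfolding root_eq by (rule triple_from_primitive) (simp add: valid_pair_def)

text \<open>Every promoted pair contains \<open>x + y\<close> or \<open>x + 2 * y\<close>, which
  exceeds 1, while the root is the pair \<open>(1, 1)\<close>.\<close>

lemma demotions_root: "demotions (3, 4, 5) = {}"
  unfolding root_eq demotions_triple_from by (auto simp: promotes_def valid_pair_def)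

lemma unique_demotion:
  assumes "T \<in> primitive_triples" "T \<noteq> (3, 4, 5)"
  shows "\<exists>!P. P \<in> demotions T"
proof -
  obtain u v where uv: "valid_pair u v" and T: "T = triple_from u v"
    using assms(1) by (rule primitive_triple_from)
  have "(u, v) \<noteq> (1, 1)" using assms(2) unfolding T root_eq by auto
  then obtain x y where xy: "promotes x y u v" using uv promotes_exists by blast
  then have "demotions T = {triple_from x y}"
    unfolding T demotions_triple_from using promotes_unique by blast
  then show ?thesis by simp
qed

section \<open>The tree of primitive triples\<close>

lemma triple_graph_simps [simp]:
  "verts triple_graph = primitive_triples"
  "arcs triple_graph = {(P, T). T \<in> promotions P}"
  "tail triple_graph = fst" "head triple_graph = snd"
  by (simp_all add: triple_graph_def)

lemma wf_triple_graph: "wf_digraph triple_graph"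
  by unfold_locales (auto dest: promotions_primitive)

lemma in_arcs_triple_graph: "in_arcs triple_graph T = (\<lambda>P. (P, T)) ` demotions T"
  by (auto simp: in_arcs_def demotions_def dest: promotions_primitive)

lemma out_arcs_triple_graph: "out_arcs triple_graph T = Pair T ` promotions T"
  by (auto simp: out_arcs_def)

lemma rooted_tree_triple_graph: "rooted_tree triple_graph (3, 4, 5)"
proof (rule wf_digraph.rooted_treeI[OF wf_triple_graph, where rank = "\<lambda>T. snd (snd T)"])
  fix T assume "T \<in> verts triple_graph" "T \<noteq> (3, 4, 5)"
  then have "\<exists>!P. P \<in> demotions T" by (simp add: unique_demotion)
  then show "\<exists>!e. e \<in> in_arcs triple_graph T" unfolding in_arcs_triple_graph by blast
qed (auto simp: root_primitive in_arcs_triple_graph demotions_root dest: promotions_hypotenuse)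

lemma infinite_primitive_triples: "infinite primitive_triples"
proof -
  \<comment> \<open>The first entry 1 is odd and coprime to everything; \<open>Suc\<close> keeps the
    second entry positive.\<close>
  have "inj (\<lambda>n. triple_from 1 (Suc n))"
    by (auto simp: inj_def triple_from_inject)
  moreover have "range (\<lambda>n. triple_from 1 (Suc n)) \<subseteq> primitive_triples"
    by (auto intro!: triple_from_primitive simp: valid_pair_def)
  ultimately show ?thesis
    by (meson finite_imageD finite_subset infinite_UNIV_nat)
qed

lemma tree_level_promotion:
  assumes "T' \<in> promotions T"
  shows "tree_level triple_graph (3, 4, 5) T' = tree_level triple_graph (3, 4, 5) T + 1"
  using tree_level_head[OF rooted_tree_triple_graph, of "(T, T')"] assms by simp

theorem corollary1:
  shows "verts triple_graph = primitive_triples \<and>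
    infinite_ternary_tree triple_graph (3, 4, 5) \<and>
    (\<forall>T \<in> primitive_triples. promotions T \<subseteq> primitive_triples \<and> card (promotions T) = 3 \<and>
       (\<forall>T' \<in> promotions T.
          tree_level triple_graph (3, 4, 5) T' = tree_level triple_graph (3, 4, 5) T + 1)) \<and>
    (\<forall>T \<in> primitive_triples. T \<noteq> (3, 4, 5) \<longrightarrow>
       (\<exists>!P. P \<in> demotions T) \<and>
       (\<forall>P \<in> demotions T.
          tree_level triple_graph (3, 4, 5) T = tree_level triple_graph (3, 4, 5) P + 1)) \<and>
    {T \<in> primitive_triples. demotions T = {}} = {(3, 4, 5)}"
proof (intro conjI ballI impI)
  show "infinite_ternary_tree triple_graph (3, 4, 5)"
    \<comment> \<open>Pairing with the tail is injective, so the out-degree equals the number of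
      promotions.\<close>
    by (auto simp: infinite_ternary_tree_def rooted_tree_triple_graph infinite_primitive_triples
        out_degree_def out_arcs_triple_graph card_image inj_on_def card_promotions)
  show "{T \<in> primitive_triples. demotions T = {}} = {(3, 4, 5)}"
    using root_primitive demotions_root unique_demotion by blast
  fix T assume T: "T \<in> primitive_triples"
  show "promotions T \<subseteq> primitive_triples" using promotions_primitive by blast
  show "card (promotions T) = 3" using T by (rule card_promotions)
  show "\<exists>!P. P \<in> demotions T" if "T \<noteq> (3, 4, 5)" using T that by (rule unique_demotion)
qed (auto simp: demotions_def tree_level_promotion)

end
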